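(* Let $\mathcal{H}_1,\mathcal{H}_2$ be Hilbert spaces, let $\mathcal{L}:\mathcal{H}_1\to\mathcal{H}_2$ be a nonzero bounded linear operator, and assume $$0<\gamma<\frac{2}{\|\mathcal{L}\|^2}.$$ For $m\in\mathcal{H}_2$ consider the Neumann series $$\sum_{j=0}^\infty (I-\gamma\mathcal{L}^*\mathcal{L})^j\,\gamma\,\mathcal{L}^* m,$$ with partial sums $\tilde S_N m=\sum_{j=0}^{N-1}(I-\gamma\mathcal{L}^*\mathcal{L})^j\gamma\mathcal{L}^* m$. Then the series converges (in $\mathcal{H}_1$) for every $m\in\mathcal{H}_2$ if and only if the problem is stable. Moreover: (a) If the problem is stable, with stability constant $\mu>0$, then $\mathcal{L}^*\mathcal{L}$ is invertible on $(\operatorname{Ker}\mathcal{L})^\perp$ with norm of the inverse equal to $1/\mu^2$. For every $m\in\mathcal{H}_2$, the limit of the series is the unique solution $f$ of $\mathcal{L}^*\mathcal{L}f=\mathcal{L}^*m$ that is orthogonal to $\operatorname{Ker}\mathcal{L}$. The convergence is uniform (in the operator norm) with rate $(1-\nu)^N/\mu$, where $\nu:=\min\left(\gamma\mu^2,\;2-\gamma\|\mathcal{L}\|^2\right)$; that is, $\|\tilde S_N m-f\|\le \frac{(1-\nu)^N}{\mu}\|m\|$ for all $m\in\mathcal{H}_2$ and $N\ge1$, where $f$ is the unique solution of $\mathcal{L}^*\mathcal{L}f=\mathcal{L}^*m$ orthogonal to $\operatorname{Ker}\mathcal{L}$. (b) If the problem is not stable, then the series does not converge uniformly (the operators $\tilde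 S_N$ do not converge in the operator norm), and it does not even converge strongly. The set of $m\in\mathcal{H}_2$ for which the sequence $\tilde S_N m$ is unbounded (and hence the series diverges) is residual, i.e., its complement is of first Baire category in $\mathcal{H}_2$; in particular, it is dense.
   Context: The problem (of inverting a bounded operator $\mathcal{L}:\mathcal{H}_1\to\mathcal{H}_2$) is called stable if there exists $\mu>0$ such that $\mu\|f\|\le\|\mathcal{L}f\|$ for all $f\in(\operatorname{Ker}\mathcal{L})^\perp$ (equivalently, $\operatorname{Ran}\mathcal{L}$ is closed). When the problem is stable, the stability constant $\mu$ denotes the largest constant with this property. Strong convergence means that $\tilde S_N m$ converges in $\mathcal{H}_1$ for every $m\in\mathcal{H}_2$. *)

theory Defs
  imports "HOL-Analysis.Analysis"
begin

text \<open>
  Scalars. A real normed field has a multiplicative norm, so by Ostrowski's theorem it is a copy of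
  the reals or of the complex numbers, and the last axiom forces \<open>scalar_conj\<close> to be the identity or
  complex conjugation, respectively.
\<close>

class rc_field = real_normed_field +
  fixes scalar_conj :: "'a \<Rightarrow> 'a"
  assumes scalar_conj_add: "scalar_conj (x + y) = scalar_conj x + scalar_conj y"
    and scalar_conj_mult: "scalar_conj (x * y) = scalar_conj x * scalar_conj y"
    and scalar_conj_conj: "scalar_conj (scalar_conj x) = x"
    and mult_scalar_conj: "x * scalar_conj x = ((norm x)\<^sup>2) *\<^sub>R 1"

instantiation real :: rc_field
begin
definition scalar_conj_real :: "real \<Rightarrow> real" where "scalar_conj_real x = x"
instance by standard (auto simp: scalar_conj_real_def power2_eq_square)
end

instantiation complex :: rc_field
begin
definition scalar_conj_complex :: "complex \<Rightarrow> complex" where "scalar_conj_complex = cnj"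
instance
proof
  fix x :: complex
  show "x * scalar_conj x = ((norm x)\<^sup>2) *\<^sub>R 1"
    by (simp add: scalar_conj_complex_def scaleR_conv_of_real flip: complex_norm_square)
qed (auto simp: scalar_conj_complex_def)
end

text \<open>
  A Hilbert space over \<open>'k\<close>. The type class \<open>real_inner\<close> supplies the norm and the underlying real
  Hilbert space; its product \<open>x \<bullet> y\<close> is then necessarily the real part of \<open>ip x y\<close>, which is linear
  in the first and conjugate linear in the second argument. For \<open>'k = real\<close> the structure is
  exactly that of the type class.
\<close>

locale hilbert_space = vector_space scale
  for scale :: "'k::rc_field \<Rightarrow> 'v::{real_inner, complete_space} \<Rightarrow> 'v" +
  fixes ip :: "'v \<Rightarrow> 'v \<Rightarrow> 'k"
  assumes scale_of_real: "scale (of_real r) x = r *\<^sub>R x"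
    and ip_add_left: "ip (x + y) z = ip x z + ip y z"
    and ip_scale_left: "ip (scale c x) y = c * ip x y"
    and ip_commute: "ip x y = scalar_conj (ip y x)"
    and ip_self: "ip x x = of_real ((norm x)\<^sup>2)"

lemma hilbert_space_real:
  "hilbert_space (scaleR :: real \<Rightarrow> 'v \<Rightarrow> 'v::{real_inner, complete_space}) inner"
  by unfold_locales
    (auto simp: algebra_simps inner_add_left scalar_conj_real_def inner_commute power2_norm_eq_inner)

lemma hilbert_space_complex:
  "hilbert_space ((*) :: complex \<Rightarrow> complex \<Rightarrow> complex) (\<lambda>x y. x * cnj y)"
  by unfold_locales
    (auto simp: algebra_simps scalar_conj_complex_def scaleR_conv_of_real simp flip: complex_norm_square)

definition Ker :: "('a::real_normed_vector \<Rightarrow>\<^sub>L 'b::real_normed_vector) \<Rightarrow> 'a set" where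
  "Ker L = {x. L x = 0}"

definition orth_compl :: "('a \<Rightarrow> 'a \<Rightarrow> 'k::zero) \<Rightarrow> 'a set \<Rightarrow> 'a set" where
  "orth_compl ip S = {x. \<forall>y\<in>S. ip x y = 0}"

text \<open>The adjoint; on Hilbert spaces it exists and is unique by the Riesz representation theorem.\<close>

definition adj ::
  "('a \<Rightarrow> 'a \<Rightarrow> 'k) \<Rightarrow> ('b \<Rightarrow> 'b \<Rightarrow> 'k) \<Rightarrow>
    ('a::real_normed_vector \<Rightarrow>\<^sub>L 'b::real_normed_vector) \<Rightarrow> 'b \<Rightarrow>\<^sub>L 'a" where
  "adj ip1 ip2 L = (THE A :: 'b \<Rightarrow>\<^sub>L 'a. \<forall>x y. ip2 (L x) y = ip1 x (A y))"

definition stability_bound ::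
  "('a \<Rightarrow> 'a \<Rightarrow> 'k::zero) \<Rightarrow> ('a::real_normed_vector \<Rightarrow>\<^sub>L 'b::real_normed_vector) \<Rightarrow> real \<Rightarrow> bool"
  where
  "stability_bound ip1 L \<mu> \<longleftrightarrow> 0 < \<mu> \<and> (\<forall>f\<in>orth_compl ip1 (Ker L). \<mu> * norm f \<le> norm (L f))"

definition is_stable ::
  "('a \<Rightarrow> 'a \<Rightarrow> 'k::zero) \<Rightarrow> ('a::real_normed_vector \<Rightarrow>\<^sub>L 'b::real_normed_vector) \<Rightarrow> bool" where
  "is_stable ip1 L \<longleftrightarrow> (\<exists>\<mu>. stability_bound ip1 L \<mu>)"

definition stability_constant ::
  "('a \<Rightarrow> 'a \<Rightarrow> 'k::zero) \<Rightarrow> ('a::real_normed_vector \<Rightarrow>\<^sub>L 'b::real_normed_vector) \<Rightarrow> real" where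
  "stability_constant ip1 L = (GREATEST \<mu>. stability_bound ip1 L \<mu>)"

primrec blinfun_power ::
  "('a::real_normed_vector \<Rightarrow>\<^sub>L 'a) \<Rightarrow> nat \<Rightarrow> 'a \<Rightarrow>\<^sub>L 'a" where
  "blinfun_power T 0 = id_blinfun"
| "blinfun_power T (Suc n) = T o\<^sub>L blinfun_power T n"

definition neumann_term ::
  "('a \<Rightarrow> 'a \<Rightarrow> 'k) \<Rightarrow> ('b \<Rightarrow> 'b \<Rightarrow> 'k) \<Rightarrow>
    ('a::real_normed_vector \<Rightarrow>\<^sub>L 'b::real_normed_vector) \<Rightarrow> real \<Rightarrow> nat \<Rightarrow> 'b \<Rightarrow>\<^sub>L 'a" where
  "neumann_term ip1 ip2 L \<gamma> j =
    blinfun_power (id_blinfun - \<gamma> *\<^sub>R (adj ip1 ip2 L o\<^sub>L L)) j o\<^sub>L (\<gamma> *\<^sub>R adj ip1 ip2 L)"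

definition neumann_sum ::
  "('a \<Rightarrow> 'a \<Rightarrow> 'k) \<Rightarrow> ('b \<Rightarrow> 'b \<Rightarrow> 'k) \<Rightarrow>
    ('a::real_normed_vector \<Rightarrow>\<^sub>L 'b::real_normed_vector) \<Rightarrow> real \<Rightarrow> nat \<Rightarrow> 'b \<Rightarrow>\<^sub>L 'a" where
  "neumann_sum ip1 ip2 L \<gamma> N = (\<Sum>j<N. neumann_term ip1 ip2 L \<gamma> j)"

text \<open>
  \<open>has_onorm_on f S c\<close>: the map \<open>f\<close> is bounded on the subspace \<open>S\<close>, with operator norm \<open>c\<close> there
  (cf. \<open>onorm\<close>, which is for maps on a whole type; the quotient at 0 is 0).
\<close>

definition has_onorm_on ::
  "('a::real_normed_vector \<Rightarrow> 'b::real_normed_vector) \<Rightarrow> 'a set \<Rightarrow> real \<Rightarrow> bool" where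
  "has_onorm_on f S c \<longleftrightarrow>
    bdd_above ((\<lambda>x. norm (f x) / norm x) ` S) \<and> (SUP x\<in>S. norm (f x) / norm x) = c"

definition nowhere_dense :: "'a::topological_space set \<Rightarrow> bool" where
  "nowhere_dense A \<longleftrightarrow> interior (closure A) = {}"

definition first_category :: "'a::topological_space set \<Rightarrow> bool" where
  "first_category A \<longleftrightarrow> (\<exists>F :: nat \<Rightarrow> 'a set. (\<forall>n. nowhere_dense (F n)) \<and> A = (\<Union>n. F n))"

definition residual :: "'a::topological_space set \<Rightarrow> bool" where
  "residual A \<longleftrightarrow> first_category (- A)"

end

theory Submission
  imports Defs
begin

text \<open>
  Write \<open>T = I - \<gamma> L\<^sup>* L\<close>. If \<open>L\<^sup>* L f = L\<^sup>* m\<close>, the partial sums telescope to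
  \<open>f - T\<^sup>N f\<close>. For a stable problem, the quadratic form of the self-adjoint operator \<open>T\<close> is bounded by
  \<open>1 - \<nu>\<close> on the orthogonal complement \<open>M\<close> of the kernel, so \<open>T\<close> is a contraction of \<open>M\<close>; this gives
  solvability (Banach's fixed point theorem) and the rate. Conversely, suppose the partial sums are
  bounded by \<open>C\<close>, and let \<open>f \<in> M\<close>. Since \<open>\<parallel>T x\<parallel>\<^sup>2 \<le> \<parallel>x\<parallel>\<^sup>2 - c \<parallel>L x\<parallel>\<^sup>2\<close> with \<open>c > 0\<close>, the series
  \<open>\<Sum>k. \<parallel>L T\<^sup>k f\<parallel>\<^sup>2\<close> converges, and \<open>\<parallel>T\<^sup>k f - T\<^bsup>k+N\<^esup> f\<parallel> \<le> C \<parallel>L T\<^sup>k f\<parallel>\<close> makes \<open>T\<^sup>k f\<close> a Cauchy sequence,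
  whose limit lies in \<open>M\<close> and in the kernel, hence is \<open>0\<close>. Letting \<open>N \<rightarrow> \<infinity>\<close> for \<open>k = 0\<close> yields
  \<open>\<parallel>f\<parallel> \<le> C \<parallel>L f\<parallel>\<close>, so the problem is stable. If it is not, the sets where the partial sums are bounded
  by \<open>n\<close> are closed, convex and symmetric with empty interior, and the Baire category theorem applies.
\<close>

section \<open>Riesz representation and adjoints\<close>

text \<open>The representing vector is the minimiser of \<open>J\<close>. The parallelogram law
  makes minimising sequences Cauchy, completeness supplies the limit, and the vanishing first
  variation there is the representation.\<close>

lemma riesz_representation:
  fixes \<phi> :: "'a::{real_inner, complete_space} \<Rightarrow> real"
  assumes "bounded_linear \<phi>"
  shows "\<exists>z. \<forall>v. \<phi> v = inner z v"
proof -
  interpret bounded_linear \<phi> by fact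
  obtain B where B: "\<And>x. norm (\<phi> x) \<le> norm x * B" using bounded by blast
  define J where "J x = (norm x)\<^sup>2 - 2 * \<phi> x" for x
  have J_lower: "- B\<^sup>2 \<le> J x" for x
  proof -
    have "\<phi> x \<le> norm x * B" using B[of x] by simp
    moreover have "0 \<le> (norm x - B)\<^sup>2" by simp
    ultimately show ?thesis unfolding J_def by (simp add: power2_diff)
  qed
  then have bdd: "bdd_below (range J)" by (intro bdd_belowI2)
  define d where "d = Inf (range J)"
  have d_le: "d \<le> J x" for x unfolding d_def by (rule cInf_lower[OF _ bdd]) simp
  have J_diff: "(norm (x - y))\<^sup>2 \<le> 2 * (J x - d) + 2 * (J y - d)" for x y
  proof -
    \<comment> \<open>Parallelogram law: the linear parts cancel, and the midpoint also has
      \<open>J\<close> at least \<open>d\<close>.\<close>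
    have "J x + J y - 2 * J ((1/2) *\<^sub>R (x + y)) = (norm (x - y))\<^sup>2 / 2"
      unfolding J_def
      by (simp add: scaleR add power2_norm_eq_inner inner_add_left inner_add_right
          inner_diff_left inner_diff_right inner_commute algebra_simps)
    with d_le[of "(1/2) *\<^sub>R (x + y)"] show ?thesis by argo
  qed
  have "\<exists>x. J x < d + 1 / Suc n" for n
  proof -
    have "Inf (range J) < d + 1 / Suc n" unfolding d_def by simp
    then show ?thesis using cInf_lessD[of "range J"] by blast
  qed
  then obtain X where X: "\<And>n. J (X n) < d + 1 / Suc n" by metis
  have "(\<lambda>n. d + 1 / Suc n) \<longlonglongrightarrow> d + 0"
    by (intro tendsto_intros LIMSEQ_Suc[OF lim_1_over_n])
  then have lim: "(\<lambda>n. d + 1 / Suc n) \<longlonglongrightarrow> d" by simp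
  have JX: "(\<lambda>n. J (X n)) \<longlonglongrightarrow> d"
  proof (rule tendsto_sandwich[OF _ _ tendsto_const lim])
    show "\<forall>\<^sub>F n in sequentially. d \<le> J (X n)" using d_le by simp
    show "\<forall>\<^sub>F n in sequentially. J (X n) \<le> d + 1 / Suc n"
      using X less_imp_le by (intro always_eventually) blast
  qed
  have "Cauchy X"
  proof (rule metric_CauchyI)
    fix e :: real assume "0 < e"
    then have "0 < e\<^sup>2 / 4" by simp
    then obtain N where N: "\<And>n. n \<ge> N \<Longrightarrow> J (X n) < d + e\<^sup>2 / 4"
      using order_tendstoD(2)[OF JX, of "d + e\<^sup>2 / 4"] by (auto simp: eventually_sequentially)
    have "dist (X m) (X n) < e" if "m \<ge> N" "n \<ge> N" for m n
    proof -
      have "(norm (X m - X n))\<^sup>2 < e\<^sup>2"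
        using J_diff[of "X m" "X n"] N[OF that(1)] N[OF that(2)] by simp
      then show ?thesis using \<open>0 < e\<close> by (simp add: dist_norm power_less_imp_less_base)
    qed
    then show "\<exists>M. \<forall>m\<ge>M. \<forall>n\<ge>M. dist (X m) (X n) < e" by blast
  qed
  then obtain z where z: "X \<longlonglongrightarrow> z" using Cauchy_convergent convergent_def by blast
  then have "(\<lambda>n. J (X n)) \<longlonglongrightarrow> J z"
    unfolding J_def by (intro tendsto_intros tendsto)
  then have Jz: "J z = d" using JX LIMSEQ_unique by blast
  have "\<phi> v = inner z v" for v
  proof (rule ccontr)
    assume "\<phi> v \<noteq> inner z v"
    define s where "s = \<phi> v - inner z v"
    \<comment> \<open>This \<open>r\<close> minimises
      \<open>r^2 * (1 + (norm v)^2) - 2 * r * s\<close>, an upper bound for the change of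
      \<open>J\<close>; the summand 1 keeps the denominator positive when
      \<open>v = 0\<close>.\<close>
    define r where "r = s / (1 + (norm v)\<^sup>2)"
    have pos: "0 < 1 + (norm v)\<^sup>2" by (simp add: add_pos_nonneg)
    have "J (z + r *\<^sub>R v) - J z = r\<^sup>2 * (norm v)\<^sup>2 - 2 * r * s"
      unfolding J_def s_def power2_norm_eq_inner
      by (simp add: scaleR add inner_add_left inner_add_right
          inner_commute algebra_simps power2_eq_square)
    also have "\<dots> < r\<^sup>2 * (1 + (norm v)\<^sup>2) - r * s"
    proof -
      have "r * s = s\<^sup>2 / (1 + (norm v)\<^sup>2)" by (simp add: r_def power2_eq_square)
      then have "0 < r * s" using \<open>\<phi> v \<noteq> inner z v\<close> pos by (simp add: s_def)
      moreover have "0 \<le> r\<^sup>2" by simp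
      ultimately have "0 < r * s + r\<^sup>2" by linarith
      then show ?thesis by (simp add: distrib_left)
    qed
    also have "\<dots> = 0" using pos by (simp add: r_def power2_eq_square)
    finally show False using d_le[of "z + r *\<^sub>R v"] Jz by simp
  qed
  then show ?thesis by blast
qed

text \<open>Test the adjoint relation with \<open>x = A y\<close> and cancel one factor
  \<open>norm (A y)\<close>. Here \<open>A\<close> is a bare function, so the estimate can serve in
  the proof that adjoints are bounded linear.\<close>

lemma norm_adjoint_le:
  fixes L :: "'a::real_inner \<Rightarrow>\<^sub>L 'b::real_inner"
  assumes adjoint: "\<And>x y. inner (L x) y = inner x (A y)"
  shows "norm (A y) \<le> norm L * norm y"
proof (cases "A y = 0")
  case False
  have "norm (A y) * norm (A y) = inner (L (A y)) y"
    by (simp add: adjoint power2_norm_eq_inner flip: power2_eq_square)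
  also have "\<dots> \<le> norm (L (A y)) * norm y" by (rule norm_cauchy_schwarz)
  also have "\<dots> \<le> (norm L * norm (A y)) * norm y"
    by (rule mult_right_mono[OF norm_blinfun]) simp
  finally show ?thesis using False by (simp add: mult.commute mult.left_commute)
qed simp

lemma adjoint_exists:
  fixes L :: "'a::{real_inner, complete_space} \<Rightarrow>\<^sub>L 'b::real_inner"
  shows "\<exists>A :: 'b \<Rightarrow>\<^sub>L 'a. \<forall>x y. inner (L x) y = inner x (A y)"
proof -
  have "\<exists>z. \<forall>x. inner (L x) y = inner z x" for y
    by (rule riesz_representation)
      (rule bounded_linear_compose[OF bounded_linear_inner_left blinfun.bounded_linear_right])
  then obtain A where A: "\<And>x y. inner (L x) y = inner (A y) x" by metis
  have "bounded_linear A"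
  proof (rule bounded_linear_intro[where K = "norm L"])
    show "A (x + y) = A x + A y" for x y
      by (rule vector_eq_rdot[THEN iffD1]) (simp add: A[symmetric] inner_add_left inner_add_right)
    show "A (r *\<^sub>R x) = r *\<^sub>R A x" for r x
      by (rule vector_eq_rdot[THEN iffD1]) (simp add: A[symmetric])
    show "norm (A y) \<le> norm y * norm L" for y
      using norm_adjoint_le[of L A y] A by (simp add: inner_commute mult.commute)
  qed
  then show ?thesis
    by (intro exI[of _ "Blinfun A"], simp add: A bounded_linear_Blinfun_apply)
      (simp add: inner_commute)
qed

section \<open>From the real inner product to the scalar-valued one\<close>

lemma scalar_conj_zero: "scalar_conj (0 :: 'k::rc_field) = 0"
  using scalar_conj_add[of "0::'k" 0] by simp

context hilbert_space
begin

lemma ip_add_right: "ip x (y + z) = ip x y + ip x z"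
  by (metis ip_add_left ip_commute scalar_conj_add)

lemma ip_diff_right: "ip x (y - z) = ip x y - ip x z"
  using ip_add_right[of x "y - z" z] by (simp add: algebra_simps)

text \<open>Both sides are twice the real part of \<open>ip x y\<close>, expressed without a
  real-part function on \<open>'k\<close>. The identity follows by expanding the squared norm of
  \<open>x + y\<close> with either product.\<close>

lemma ip_plus_ip: "ip x y + ip y x = of_real (2 * inner x y)"
proof -
  have "of_real ((norm (x + y))\<^sup>2) = ip x x + (ip x y + ip y x) + ip y y"
    unfolding ip_self[symmetric] by (simp add: ip_add_left ip_add_right algebra_simps)
  moreover have "(norm (x + y))\<^sup>2 = (norm x)\<^sup>2 + 2 * inner x y + (norm y)\<^sup>2"
    by (simp add: power2_norm_eq_inner inner_add_left inner_add_right inner_commute)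
  ultimately show ?thesis by (simp add: ip_self)
qed

lemma ip_zero_imp_inner_zero:
  assumes "ip x y = 0"
  shows "inner x y = 0"
proof -
  have "ip y x = 0"
    using assms ip_commute[of y x] by (simp add: scalar_conj_zero)
  with assms ip_plus_ip[of x y] show ?thesis by simp
qed

lemma ip_eq_zero_iff: "(\<forall>x. ip x y = 0) \<longleftrightarrow> y = 0"
proof
  show "y = 0" if "\<forall>x. ip x y = 0"
    using that ip_self[of y] by simp
  show "\<forall>x. ip x y = 0" if "y = 0"
    using that ip_diff_right[of _ 0 0] by simp
qed

end

text \<open>The choice \<open>c = scalar_conj z\<close> turns the assumption into
  \<open>2 * (norm z)^2 = 0\<close>. This lifts identities between real parts to identities in
  \<open>'k\<close>.\<close>

lemma scalar_zero_if_real_parts_zero: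
  fixes z :: "'k::rc_field"
  assumes "\<And>c. c * z + scalar_conj (c * z) = 0"
  shows "z = 0"
proof -
  have "scalar_conj (scalar_conj z * z) = z * scalar_conj z"
    by (simp add: scalar_conj_mult scalar_conj_conj)
  then have "scalar_conj z * z + scalar_conj (scalar_conj z * z) = of_real (2 * (norm z)\<^sup>2)"
    using mult_scalar_conj[of z] by (simp add: mult.commute scaleR_conv_of_real)
  then have "(of_real (2 * (norm z)\<^sup>2) :: 'k) = 0" using assms by metis
  then show ?thesis unfolding of_real_eq_0_iff by simp
qed

text \<open>If \<open>x\<close> is orthogonal to \<open>K\<close> in the real sense, then for
  \<open>y\<close> in \<open>K\<close> so is it to every multiple \<open>scale c y\<close>; hence
  all real parts of \<open>c * ip y x\<close> vanish.\<close>

lemma orth_compl_ip_eq_inner: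
  fixes scale :: "'k::rc_field \<Rightarrow> 'v::{real_inner, complete_space} \<Rightarrow> 'v"
    and ip :: "'v \<Rightarrow> 'v \<Rightarrow> 'k"
  assumes "hilbert_space scale ip"
    and closed: "\<And>c x. x \<in> K \<Longrightarrow> scale c x \<in> K"
  shows "orth_compl ip K = orth_compl inner K"
proof -
  interpret hilbert_space scale ip by fact
  have "ip x y = 0" if orth: "\<And>y. y \<in> K \<Longrightarrow> inner x y = 0" and "y \<in> K" for x y
  proof -
    have "ip y x = 0"
    proof (rule scalar_zero_if_real_parts_zero)
      fix c
      have "ip (scale c y) x + ip x (scale c y) = 0"
        using orth[OF closed[OF \<open>y \<in> K\<close>, of c]] ip_plus_ip[of "scale c y" x]
        by (simp add: inner_commute)
      then show "c * ip y x + scalar_conj (c * ip y x) = 0"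
        using ip_commute[of x "scale c y"] by (simp add: ip_scale_left)
    qed
    then show ?thesis
      using ip_commute[of x y] by (simp add: scalar_conj_zero)
  qed
  then show ?thesis
    unfolding orth_compl_def using ip_zero_imp_inner_zero by blast
qed

text \<open>Replacing \<open>x\<close> by \<open>scale1 c x\<close> in the real adjoint relation and
  using scalar linearity of \<open>L\<close> yields the relation for \<open>ip1\<close> and
  \<open>ip2\<close>. Nondegeneracy of \<open>ip1\<close> gives the uniqueness that the description
  in \<open>adj\<close> requires.\<close>

lemma adj_eqI:
  fixes L :: "'a::{real_inner, complete_space} \<Rightarrow>\<^sub>L 'b::{real_inner, complete_space}"
    and A :: "'b \<Rightarrow>\<^sub>L 'a"
  assumes "hilbert_space scale1 ip1" "hilbert_space scale2 ip2"
    and lin: "\<And>c x. L (scale1 c x) = scale2 c (L x)"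
    and A: "\<And>x y. inner (L x) y = inner x (A y)"
  shows "adj ip1 ip2 L = A"
proof -
  interpret H1: hilbert_space scale1 ip1 by fact
  interpret H2: hilbert_space scale2 ip2 by fact
  have adj: "ip2 (L x) y = ip1 x (A y)" for x y
  proof -
    have "ip2 (L x) y - ip1 x (A y) = 0"
    proof (rule scalar_zero_if_real_parts_zero)
      fix c
      have "ip2 (L (scale1 c x)) y + ip2 y (L (scale1 c x)) =
          ip1 (scale1 c x) (A y) + ip1 (A y) (scale1 c x)"
        by (simp add: H1.ip_plus_ip H2.ip_plus_ip A)
      then have "c * ip2 (L x) y + scalar_conj (c * ip2 (L x) y) =
          c * ip1 x (A y) + scalar_conj (c * ip1 x (A y))"
        using H2.ip_commute[of y "scale2 c (L x)"] H1.ip_commute[of "A y" "scale1 c x"]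
        by (simp add: lin H1.ip_scale_left H2.ip_scale_left)
      moreover have "scalar_conj (c * ip2 (L x) y) =
          scalar_conj (c * (ip2 (L x) y - ip1 x (A y))) + scalar_conj (c * ip1 x (A y))"
        by (simp add: algebra_simps flip: scalar_conj_add)
      ultimately show "c * (ip2 (L x) y - ip1 x (A y)) +
          scalar_conj (c * (ip2 (L x) y - ip1 x (A y))) = 0"
        by (simp add: algebra_simps)
    qed
    then show ?thesis by simp
  qed
  have "B = A" if "\<forall>x y. ip2 (L x) y = ip1 x (B y)" for B :: "'b \<Rightarrow>\<^sub>L 'a"
  proof (rule blinfun_eqI)
    fix y
    have "\<forall>x. ip1 x (B y - A y) = 0" using that adj by (simp add: H1.ip_diff_right)
    then show "B y = A y" unfolding H1.ip_eq_zero_iff by simp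
  qed
  then show ?thesis unfolding adj_def using adj by (intro the_equality) auto
qed

section \<open>Quadratic forms and Baire category\<close>

lemma norm_le_quadratic_form_bound:
  fixes T :: "'a::real_inner \<Rightarrow>\<^sub>L 'a"
  assumes sym: "\<And>x y. inner (T x) y = inner x (T y)"
    and M: "subspace M" "\<And>x. x \<in> M \<Longrightarrow> T x \<in> M"
    and q: "\<And>x. x \<in> M \<Longrightarrow> \<bar>inner (T x) x\<bar> \<le> q * (norm x)\<^sup>2"
    and x: "x \<in> M"
  shows "norm (T x) \<le> q * norm x"
proof (cases "T x = 0 \<or> x = 0")
  case True
  show ?thesis
  proof (cases "x = 0")
    case False
    have "0 \<le> q * (norm x)\<^sup>2" using q[OF x] by linarith
    with False have "0 \<le> q" by (simp add: zero_le_mult_iff)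
    with True False show ?thesis by simp
  qed simp
next
  case False
  \<comment> \<open>Rescaling \<open>T x\<close> to the length of \<open>x\<close> makes
    \<open>inner (T x) y\<close> equal to \<open>norm x * norm (T x)\<close>. Polarization expresses
    it by the quadratic form at \<open>x + y\<close> and \<open>x - y\<close>, and the parallelogram
    law sums the two bounds.\<close>
  define y where "y = (norm x / norm (T x)) *\<^sub>R T x"
  have "y \<in> M" unfolding y_def using M x by (simp add: subspace_scale)
  have "norm y = norm x" using False by (simp add: y_def)
  have "4 * (norm x * norm (T x)) = 4 * inner (T x) y"
    using False by (simp add: y_def power2_eq_square flip: power2_norm_eq_inner)
  also have "\<dots> = inner (T (x + y)) (x + y) - inner (T (x - y)) (x - y)"
    using sym[of x y]
    by (simp add: blinfun.add_right blinfun.diff_right inner_add_left inner_add_right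
        inner_diff_left inner_diff_right inner_commute)
  also have "\<dots> \<le> q * (norm (x + y))\<^sup>2 + q * (norm (x - y))\<^sup>2"
    using q[OF subspace_add[OF M(1) x \<open>y \<in> M\<close>]] q[OF subspace_diff[OF M(1) x \<open>y \<in> M\<close>]] by linarith
  also have "\<dots> = q * (2 * (norm x)\<^sup>2 + 2 * (norm y)\<^sup>2)"
    by (simp add: power2_norm_eq_inner inner_add_left inner_add_right
        inner_diff_left inner_diff_right inner_commute algebra_simps)
  also have "\<dots> = 4 * (norm x * (q * norm x))"
    using \<open>norm y = norm x\<close> by (simp add: power2_eq_square)
  finally show ?thesis using False by simp
qed

section \<open>Uniform boundedness and residual sets\<close>

lemma closed_bounded_orbit_set:
  fixes F :: "nat \<Rightarrow> 'b::real_normed_vector \<Rightarrow>\<^sub>L 'a::real_normed_vector"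
  shows "closed {m. \<forall>N. norm (F N m) \<le> c}"
  by (intro closed_Collect_all closed_Collect_le continuous_intros)

lemma uniformly_bounded_if_interior_nonempty:
  fixes F :: "nat \<Rightarrow> 'b::real_normed_vector \<Rightarrow>\<^sub>L 'a::real_normed_vector"
  assumes "interior {m. \<forall>N. norm (F N m) \<le> c} \<noteq> {}"
  shows "\<exists>C. \<forall>N. norm (F N) \<le> C"
proof -
  obtain m0 where "m0 \<in> interior {m. \<forall>N. norm (F N m) \<le> c}" using assms by blast
  then obtain e where e: "e > 0" "cball m0 e \<subseteq> {m. \<forall>N. norm (F N m) \<le> c}"
    by (auto simp: mem_interior_cball)
  have "m0 \<in> cball m0 e" using e by simp
  then have m0: "norm (F N m0) \<le> c" for N using e(2) by blast
  then have "0 \<le> c" using norm_ge_zero order_trans by blast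
  have "norm (F N) \<le> 2 * c / e" for N
  proof (rule norm_blinfun_bound)
    show "0 \<le> 2 * c / e" using \<open>0 \<le> c\<close> e by simp
    fix m :: 'b
    show "norm (F N m) \<le> 2 * c / e * norm m"
    proof (cases "m = 0")
      case False
      \<comment> \<open>Here \<open>u\<close> is \<open>m\<close> rescaled to length
        \<open>e\<close>. As the difference of \<open>m0 + u\<close> and \<open>m0\<close>, both in
        the ball, it has images of norm at most \<open>2 * c\<close>.\<close>
      define u where "u = (e / norm m) *\<^sub>R m"
      have "m0 + u \<in> cball m0 e" using False e by (simp add: u_def dist_norm)
      then have "norm (F N (m0 + u)) \<le> c" using e(2) by blast
      moreover have "norm (F N u) = norm (F N (m0 + u) - F N m0)"
        by (simp add: blinfun.add_right)
      ultimately have "norm (F N u) \<le> 2 * c"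
        using norm_triangle_ineq4[of "F N (m0 + u)" "F N m0"] m0[of N] by linarith
      then have "e / norm m * norm (F N m) \<le> 2 * c"
        using e by (simp add: u_def blinfun.scaleR_right)
      then show ?thesis using e False by (simp add: field_simps)
    qed simp
  qed
  then show ?thesis by blast
qed

lemma residual_unbounded_orbits:
  fixes F :: "nat \<Rightarrow> 'b::real_normed_vector \<Rightarrow>\<^sub>L 'a::real_normed_vector"
  assumes "\<not> (\<exists>C. \<forall>N. norm (F N) \<le> C)"
  shows "residual {m. \<not> bounded (range (\<lambda>N. F N m))}"
proof -
  have "nowhere_dense {m. \<forall>N. norm (F N m) \<le> real n}" for n
    unfolding nowhere_dense_def closure_closed[OF closed_bounded_orbit_set]
    using uniformly_bounded_if_interior_nonempty assms by blast
  moreover have "- {m. \<not> bounded (range (\<lambda>N. F N m))} = (\<Union>n. {m. \<forall>N. norm (F N m) \<le> real n})"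
  proof -
    have "bounded (range (\<lambda>N. F N m)) \<longleftrightarrow> (\<exists>n. \<forall>N. norm (F N m) \<le> real n)" for m
      unfolding bounded_iff by (auto intro: order_trans[OF _ real_nat_ceiling_ge])
    then show ?thesis by auto
  qed
  ultimately show ?thesis
    unfolding residual_def first_category_def
    by (intro exI[of _ "\<lambda>n. {m. \<forall>N. norm (F N m) \<le> real n}"]) simp
qed

lemma residual_imp_dense:
  fixes A :: "'b::complete_space set"
  assumes "residual A"
  shows "closure A = UNIV"
proof -
  obtain F :: "nat \<Rightarrow> 'b set" where F: "\<And>n. nowhere_dense (F n)" "- A = (\<Union>n. F n)"
    using assms unfolding residual_def first_category_def by blast
  have "euclidean interior_of \<Union>(range (\<lambda>n. closure (F n))) = {}"
    by (rule Baire_category_alt)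
      (use F(1) in \<open>auto simp: completely_metrizable_space_euclidean nowhere_dense_def\<close>)
  moreover have "- A \<subseteq> \<Union>(range (\<lambda>n. closure (F n)))"
    unfolding F(2) using closure_subset by blast
  ultimately have "interior (- A) = {}"
    using interior_mono[of "- A" "\<Union>(range (\<lambda>n. closure (F n)))"] by auto
  then show ?thesis unfolding interior_complement by blast
qed

section \<open>The Neumann series\<close>

lemma blinfun_power_commute: "blinfun_power T (Suc n) x = blinfun_power T n (T x)"
  by (induction n) simp_all

lemma blinfun_power_add: "blinfun_power T (m + n) x = blinfun_power T m (blinfun_power T n x)"
  by (induction m) simp_all

text \<open>The analytic core uses only the real inner products. \<open>A\<close> stands for the
  real adjoint, which \<open>adj_eqI\<close> later identifies with the scalar one.\<close>

locale landweber =
  fixes L :: "'a::{real_inner, complete_space} \<Rightarrow>\<^sub>L 'b::{real_inner, complete_space}"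
    and A :: "'b \<Rightarrow>\<^sub>L 'a"
    and \<gamma> :: real
  assumes adjoint: "inner (L x) y = inner x (A y)"
    and nonzero: "L \<noteq> 0"
    and gamma: "0 < \<gamma>" "\<gamma> < 2 / (norm L)\<^sup>2"
begin

definition M :: "'a set" where "M = orth_compl inner (Ker L)"

definition T :: "'a \<Rightarrow>\<^sub>L 'a" where "T = id_blinfun - \<gamma> *\<^sub>R (A o\<^sub>L L)"

abbreviation P :: "nat \<Rightarrow> 'a \<Rightarrow>\<^sub>L 'a" where "P \<equiv> blinfun_power T"

definition S :: "nat \<Rightarrow> 'b \<Rightarrow>\<^sub>L 'a" where "S N = (\<Sum>j<N. P j o\<^sub>L (\<gamma> *\<^sub>R A))"

lemma T_apply: "T x = x - \<gamma> *\<^sub>R A (L x)"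
  by (simp add: T_def blinfun.diff_left blinfun.scaleR_left)

lemma mem_M: "x \<in> M \<longleftrightarrow> (\<forall>y. L y = 0 \<longrightarrow> inner x y = 0)"
  by (simp add: M_def orth_compl_def Ker_def)

lemma subspace_M: "subspace M"
  by (auto simp: subspace_def mem_M inner_add_left)

lemma closed_M: "closed M"
proof -
  have "M = (\<Inter>y\<in>Ker L. {x. inner x y = 0})" by (auto simp: mem_M Ker_def)
  moreover have "closed {x. inner x y = 0}" for y :: 'a
    by (intro closed_Collect_eq continuous_intros)
  ultimately show ?thesis by auto
qed

lemma A_in_M: "A y \<in> M"
  unfolding mem_M using adjoint by (metis inner_commute inner_zero_left)

lemma T_in_M: "x \<in> M \<Longrightarrow> T x \<in> M"
  unfolding T_apply by (intro subspace_diff subspace_scale subspace_M A_in_M)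

lemma M_ker_zero: "x \<in> M \<Longrightarrow> L x = 0 \<Longrightarrow> x = 0"
  using mem_M inner_eq_zero_iff by blast

lemma inner_AL: "inner (A (L x)) y = inner (L x) (L y)"
  using adjoint[of y "L x"] by (simp add: inner_commute)

lemma norm_L_pos: "0 < norm L"
  using nonzero by simp

lemma gamma_norm_L: "\<gamma> * (norm L)\<^sup>2 < 2"
  using gamma(2) norm_L_pos by (simp add: pos_less_divide_eq)

text \<open>A nonzero vector of \<open>M\<close> bounds the set of stability bounds from above and
  forces \<open>rate\<close> to be nonnegative and the norm of the inverse to be positive.\<close>

lemma M_nontrivial: "\<exists>f\<in>M. f \<noteq> 0"
proof -
  obtain x where "L x \<noteq> 0" using nonzero by (metis blinfun_eqI zero_blinfun.rep_eq)
  then have "A (L x) \<noteq> 0" using inner_AL[of x x] by auto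
  then show ?thesis using A_in_M by blast
qed

lemma M_AL_inject:
  assumes "f \<in> M" "g \<in> M" "A (L f) = A (L g)"
  shows "f = g"
proof -
  have "inner (L (f - g)) (L (f - g)) = 0"
    using inner_AL[of "f - g" "f - g"] assms(3) by (simp add: blinfun.diff_right)
  then show ?thesis using M_ker_zero[of "f - g"] subspace_diff[OF subspace_M assms(1,2)] by simp
qed

text \<open>Here \<open>f\<close> is any solution, not only the one in \<open>M\<close>: the
  converse direction applies this with \<open>m = L f\<close> for arbitrary
  \<open>f\<close>.\<close>

lemma S_apply:
  assumes "A (L f) = A m"
  shows "S N m = f - P N f"
proof -
  have "\<gamma> *\<^sub>R A m = f - T f" by (simp add: T_apply assms)
  then have "S N m = (\<Sum>j<N. P j f - P (Suc j) f)"
    by (simp add: S_def blinfun.sum_left blinfun.scaleR_left blinfun.diff_right blinfun_power_commute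
        del: blinfun_power.simps)
  also have "\<dots> = f - P N f"
    using sum_lessThan_telescope'[of "\<lambda>j. P j f" N] by simp
  finally show ?thesis .
qed

lemma T_symmetric: "inner (T x) y = inner x (T y)"
  using inner_AL[of x y] inner_AL[of y x]
  by (simp add: T_apply inner_diff_left inner_diff_right inner_commute)

subsection \<open>Stable problems\<close>

abbreviation bound :: "real \<Rightarrow> bool" where "bound \<equiv> stability_bound inner L"

lemma bound_iff: "bound \<mu> \<longleftrightarrow> 0 < \<mu> \<and> (\<forall>f\<in>M. \<mu> * norm f \<le> norm (L f))"
  by (simp add: stability_bound_def M_def)

text \<open>The \<open>GREATEST\<close> operator is meaningful only if a maximum exists. The
  supremum of all bounds is finite by \<open>norm L\<close>, and it is itself a bound because the
  defining inequalities survive suprema.\<close>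

lemma stability_constant_greatest:
  assumes "is_stable inner L"
  shows "bound (stability_constant inner L)"
    and "bound \<mu> \<Longrightarrow> \<mu> \<le> stability_constant inner L"
proof -
  define s where "s = Sup (Collect bound)"
  obtain f where f: "f \<in> M" "f \<noteq> 0" using M_nontrivial by blast
  have bdd: "bdd_above (Collect bound)"
  proof (rule bdd_aboveI)
    fix \<mu> assume "\<mu> \<in> Collect bound"
    then have "\<mu> * norm f \<le> norm (L f)" using f by (simp add: bound_iff)
    also have "\<dots> \<le> norm L * norm f" by (rule norm_blinfun)
    finally show "\<mu> \<le> norm L" using f by simp
  qed
  have le: "\<mu> \<le> s" if "bound \<mu>" for \<mu>
    unfolding s_def using that bdd by (intro cSup_upper) auto
  have ne: "Collect bound \<noteq> {}" using assms by (auto simp: is_stable_def)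
  have "s * norm f \<le> norm (L f)" if "f \<in> M" for f
  proof (cases "f = 0")
    case False
    have "s \<le> norm (L f) / norm f"
      unfolding s_def using that False
      by (intro cSup_least ne) (auto simp: bound_iff pos_le_divide_eq)
    then show ?thesis using False by (simp add: pos_le_divide_eq)
  qed simp
  moreover have "0 < s" using ne le by (fastforce simp: bound_iff)
  ultimately have s: "bound s" by (simp add: bound_iff)
  have "stability_constant inner L = s"
    unfolding stability_constant_def by (rule Greatest_equality[where P = bound, OF s le])
  with s le show "bound (stability_constant inner L)"
    and "bound \<mu> \<Longrightarrow> \<mu> \<le> stability_constant inner L" by simp_all
qed

text \<open>This is 1 - \<nu>, the larger of \<open>1 - \<gamma> * \<mu>\<^sup>2\<close> and
  \<open>\<gamma> * (norm L)\<^sup>2 - 1\<close>.\<close>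

definition rate :: "real \<Rightarrow> real" where
  "rate \<mu> = 1 - min (\<gamma> * \<mu>\<^sup>2) (2 - \<gamma> * (norm L)\<^sup>2)"

context
  fixes \<mu> :: real
  assumes bound: "bound \<mu>"
begin

lemma mu_pos: "0 < \<mu>"
  and mu_le: "f \<in> M \<Longrightarrow> \<mu> * norm f \<le> norm (L f)"
  using bound by (auto simp: bound_iff)

lemma norm_T_le:
  assumes "x \<in> M"
  shows "norm (T x) \<le> rate \<mu> * norm x"
proof (rule norm_le_quadratic_form_bound[OF T_symmetric subspace_M T_in_M _ assms])
  fix x assume "x \<in> M"
  \<comment> \<open>The lower bound on \<open>norm (L x)\<close> by stability limits this form from
    above, and the operator norm of \<open>L\<close> limits it from below; these give the two
    entries in \<open>rate\<close>.\<close>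
  have eq: "inner (T x) x = (norm x)\<^sup>2 - \<gamma> * (norm (L x))\<^sup>2"
    by (simp add: T_apply inner_diff_left inner_AL power2_norm_eq_inner)
  have "(\<mu> * norm x)\<^sup>2 \<le> (norm (L x))\<^sup>2"
    using mu_le[OF \<open>x \<in> M\<close>] mu_pos by (intro power_mono) auto
  then have 1: "\<gamma> * (\<mu> * norm x)\<^sup>2 \<le> \<gamma> * (norm (L x))\<^sup>2"
    using gamma(1) by simp
  have "(norm (L x))\<^sup>2 \<le> (norm L * norm x)\<^sup>2"
    by (intro power_mono norm_blinfun) auto
  then have 2: "\<gamma> * (norm (L x))\<^sup>2 \<le> \<gamma> * (norm L * norm x)\<^sup>2"
    using gamma(1) by simp
  have "(1 - \<gamma> * \<mu>\<^sup>2) * (norm x)\<^sup>2 \<le> rate \<mu> * (norm x)\<^sup>2"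
    "(\<gamma> * (norm L)\<^sup>2 - 1) * (norm x)\<^sup>2 \<le> rate \<mu> * (norm x)\<^sup>2"
    by (auto simp: rate_def intro!: mult_right_mono)
  with 1 2 show "\<bar>inner (T x) x\<bar> \<le> rate \<mu> * (norm x)\<^sup>2"
    unfolding eq by (simp add: power_mult_distrib algebra_simps abs_le_iff)
qed

lemma rate_bounds: "0 \<le> rate \<mu>" "rate \<mu> < 1"
proof -
  obtain f where f: "f \<in> M" "f \<noteq> 0" using M_nontrivial by blast
  have "0 \<le> rate \<mu> * norm f" using norm_T_le[OF f(1)] norm_ge_zero order_trans by blast
  then show "0 \<le> rate \<mu>" using f(2) by (simp add: zero_le_mult_iff)
  show "rate \<mu> < 1" using gamma(1) gamma_norm_L mu_pos by (simp add: rate_def)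
qed

lemma norm_P_le:
  assumes "x \<in> M"
  shows "P n x \<in> M \<and> norm (P n x) \<le> rate \<mu> ^ n * norm x"
proof (induction n)
  case (Suc n)
  then have "norm (T (P n x)) \<le> rate \<mu> * norm (P n x)" by (intro norm_T_le) simp
  also have "\<dots> \<le> rate \<mu> * (rate \<mu> ^ n * norm x)"
    using Suc rate_bounds by (intro mult_left_mono) auto
  finally show ?case using Suc T_in_M by (simp add: mult.assoc)
qed (use assms in simp)

text \<open>The equation \<open>A (L f) = g\<close> says that \<open>f\<close> is a fixed point of
  \<open>f \<mapsto> T f + \<gamma> *\<^sub>R g\<close>, a contraction of the closed set
  \<open>M\<close>.\<close>

lemma AL_surj:
  assumes "g \<in> M"
  shows "\<exists>f\<in>M. A (L f) = g"
proof -
  have "\<exists>!f\<in>M. T f + \<gamma> *\<^sub>R g = f"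
  proof (rule Banach_fix[OF _ _ rate_bounds])
    show "complete M" using closed_M complete_UNIV by (metis complete_Int_closed inf_top_left)
    show "M \<noteq> {}" using M_nontrivial by blast
    show "(\<lambda>f. T f + \<gamma> *\<^sub>R g) ` M \<subseteq> M"
      using T_in_M assms by (auto intro!: subspace_add subspace_scale subspace_M)
    show "dist (T x + \<gamma> *\<^sub>R g) (T y + \<gamma> *\<^sub>R g) \<le> rate \<mu> * dist x y" if "x \<in> M" "y \<in> M" for x y
      using norm_T_le[OF subspace_diff[OF subspace_M that]]
      by (simp add: dist_norm blinfun.diff_right)
  qed
  then obtain f where "f \<in> M" "T f + \<gamma> *\<^sub>R g = f" by blast
  then have "\<gamma> *\<^sub>R A (L f) = \<gamma> *\<^sub>R g" by (auto simp: T_apply algebra_simps)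
  then show ?thesis using gamma(1) \<open>f \<in> M\<close> by auto
qed

lemma bij_betw_AL: "bij_betw (\<lambda>f. A (L f)) M M"
  unfolding bij_betw_def inj_on_def
  using M_AL_inject A_in_M AL_surj by blast

lemma ex1_solution: "\<exists>!f. f \<in> M \<and> A (L f) = A m"
  using AL_surj[OF A_in_M] M_AL_inject by metis

text \<open>Pairing the normal equation with \<open>f\<close> gives
  \<open>norm (L f) \<le> norm m\<close>. This route yields the sharp factor 1/\<mu>, whereas
  inverting \<open>A L\<close> directly would give \<open>norm L / \<mu>\<^sup>2\<close>.\<close>

lemma norm_solution_le:
  assumes f: "f \<in> M" "A (L f) = A m"
  shows "norm f \<le> norm m / \<mu>"
proof -
  have "norm (L f) * norm (L f) = inner (L f) m"
    using adjoint[of f m] adjoint[of f "L f"] f(2)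
    by (simp add: power2_norm_eq_inner flip: power2_eq_square)
  also have "\<dots> \<le> norm (L f) * norm m" by (rule norm_cauchy_schwarz)
  finally have "norm (L f) \<le> norm m"
    by (cases "L f = 0") simp_all
  then have "\<mu> * norm f \<le> norm m" using mu_le[OF f(1)] by simp
  then show ?thesis using mu_pos by (simp add: pos_le_divide_eq mult.commute)
qed

lemma norm_S_diff_le:
  assumes f: "f \<in> M" "A (L f) = A m"
  shows "norm (S N m - f) \<le> rate \<mu> ^ N / \<mu> * norm m"
proof -
  have "norm (S N m - f) = norm (P N f)" by (simp add: S_apply[OF f(2)])
  also have "\<dots> \<le> rate \<mu> ^ N * norm f" using norm_P_le[OF f(1)] by simp
  also have "\<dots> \<le> rate \<mu> ^ N * (norm m / \<mu>)"
    using norm_solution_le[OF f] rate_bounds by (intro mult_left_mono) auto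
  finally show ?thesis by simp
qed

lemma S_tendsto_solution:
  assumes f: "f \<in> M" "A (L f) = A m"
  shows "(\<lambda>N. S N m) \<longlonglongrightarrow> f"
proof (rule LIM_zero_cancel, rule tendsto_0_le[where K = 1])
  show "(\<lambda>N. rate \<mu> ^ N / \<mu> * norm m) \<longlonglongrightarrow> 0"
    using tendsto_mult_left_zero[OF tendsto_mult_left_zero[OF LIMSEQ_realpow_zero[OF rate_bounds]],
        of "inverse \<mu>" "norm m"] by (simp add: divide_inverse)
  show "\<forall>\<^sub>F N in sequentially. norm (S N m - f) \<le> norm (rate \<mu> ^ N / \<mu> * norm m) * 1"
    using norm_S_diff_le[OF f] rate_bounds mu_pos by (intro always_eventually) (simp add: abs_mult)
qed

lemma uniform_limit_S: "\<exists>S'. S \<longlonglongrightarrow> S' \<and> (\<forall>N. norm (S N - S') \<le> rate \<mu> ^ N / \<mu>)"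
proof -
  \<comment> \<open>The solution operator is the candidate limit (the Moore-Penrose inverse of
    \<open>L\<close>); uniqueness of solutions in \<open>M\<close> makes it linear.\<close>
  define R where "R m = (THE f. f \<in> M \<and> A (L f) = A m)" for m
  have R: "R m \<in> M" "A (L (R m)) = A m" for m
    using theI'[OF ex1_solution[of m]] unfolding R_def by auto
  have R_eq: "R m = f" if "f \<in> M" "A (L f) = A m" for m f
    using M_AL_inject R that by simp
  have "bounded_linear R"
  proof (rule bounded_linear_intro[where K = "1 / \<mu>"])
    show "R (x + y) = R x + R y" for x y
      by (rule R_eq) (simp_all add: R blinfun.add_right subspace_add[OF subspace_M])
    show "R (r *\<^sub>R x) = r *\<^sub>R R x" for r x
      by (rule R_eq) (simp_all add: R blinfun.scaleR_right subspace_scale[OF subspace_M])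
    show "norm (R x) \<le> norm x * (1 / \<mu>)" for x
      using norm_solution_le[OF R] by simp
  qed
  then have app: "Blinfun R m = R m" for m by (simp add: bounded_linear_Blinfun_apply)
  have le: "norm (S N - Blinfun R) \<le> rate \<mu> ^ N / \<mu>" for N
    using norm_S_diff_le[OF R] rate_bounds mu_pos
    by (intro norm_blinfun_bound) (simp_all add: blinfun.diff_left app)
  have "S \<longlonglongrightarrow> Blinfun R"
  proof (rule LIM_zero_cancel, rule tendsto_0_le[where K = 1])
    show "(\<lambda>N. rate \<mu> ^ N / \<mu>) \<longlonglongrightarrow> 0"
      using tendsto_mult_left_zero[OF LIMSEQ_realpow_zero[OF rate_bounds], of "inverse \<mu>"]
      by (simp add: divide_inverse)
    show "\<forall>\<^sub>F N in sequentially. norm (S N - Blinfun R) \<le> norm (rate \<mu> ^ N / \<mu>) * 1"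
      using le rate_bounds mu_pos by (intro always_eventually) simp
  qed
  with le show ?thesis by blast
qed

lemma norm_le_norm_AL:
  assumes "f \<in> M"
  shows "\<mu>\<^sup>2 * norm f \<le> norm (A (L f))"
proof (cases "f = 0")
  case False
  have "norm f * (\<mu>\<^sup>2 * norm f) = (\<mu> * norm f)\<^sup>2" by (simp add: power2_eq_square)
  also have "\<dots> \<le> (norm (L f))\<^sup>2"
    using mu_le[OF assms] mu_pos by (intro power_mono) auto
  also have "\<dots> = inner (A (L f)) f" by (simp add: inner_AL power2_norm_eq_inner)
  also have "\<dots> \<le> norm f * norm (A (L f))"
    using norm_cauchy_schwarz[of "A (L f)" f] by (simp add: mult.commute)
  finally show ?thesis using False by simp
qed simp

end

text \<open>With \<open>L\<^sup>* L h = f\<close> one has \<open>\<parallel>f\<parallel>\<^sup>2 = \<langle>L f, L h\<rangle>\<close> and \<open>\<parallel>L h\<parallel>\<^sup>2 = \<langle>f, h\<rangle>\<close>.\<close>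

lemma bound_of_inverse_bound:
  assumes surj: "\<And>f. f \<in> M \<Longrightarrow> \<exists>h\<in>M. A (L h) = f"
    and c: "0 < c" "\<And>h. h \<in> M \<Longrightarrow> norm h \<le> c * norm (A (L h))"
  shows "bound (1 / sqrt c)"
proof -
  have "norm f \<le> sqrt c * norm (L f)" if f: "f \<in> M" for f
  proof (cases "f = 0")
    case False
    obtain h where h: "h \<in> M" "A (L h) = f" using surj[OF f] by blast
    have "(norm (L h))\<^sup>2 = inner f h"
      using inner_AL[of h h] h(2) by (simp add: power2_norm_eq_inner)
    also have "\<dots> \<le> norm f * norm h" by (rule norm_cauchy_schwarz)
    also have "\<dots> \<le> norm f * (c * norm f)"
      using c(2)[OF h(1)] h(2) by (intro mult_left_mono) auto
    also have "\<dots> = (sqrt c * norm f)\<^sup>2" using c(1) by (simp add: power2_eq_square)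
    finally have Lh: "norm (L h) \<le> sqrt c * norm f"
      by (rule power2_le_imp_le) (use c(1) in simp)
    have "norm f * norm f = inner (L h) (L f)"
      using inner_AL[of h f] h(2) by (simp add: power2_norm_eq_inner flip: power2_eq_square)
    also have "\<dots> \<le> norm (L h) * norm (L f)" by (rule norm_cauchy_schwarz)
    also have "\<dots> \<le> (sqrt c * norm f) * norm (L f)" using Lh by (intro mult_right_mono) auto
    finally show ?thesis using False by (simp add: mult.left_commute mult.commute)
  qed simp
  then show ?thesis using c(1) by (simp add: bound_iff pos_divide_le_eq mult.commute)
qed

text \<open>The upper bound is \<open>norm_le_norm_AL\<close>. Conversely, if \<open>c\<close> is
  the norm of the inverse, then \<open>1 / sqrt c\<close> is a stability bound, so maximality of
  \<mu> gives \<open>1 / sqrt c \<le> \<mu>\<close>.\<close>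

lemma has_onorm_on_inverse:
  assumes "is_stable inner L"
  defines "\<mu> \<equiv> stability_constant inner L"
  shows "has_onorm_on (inv_into M (\<lambda>f. A (L f))) M (1 / \<mu>\<^sup>2)"
proof -
  define G where "G = inv_into M (\<lambda>f. A (L f))"
  have mu: "bound \<mu>" unfolding \<mu>_def by (rule stability_constant_greatest[OF assms(1)])
  have mu0: "0 < \<mu>" using mu by (rule mu_pos)
  have bij: "bij_betw (\<lambda>f. A (L f)) M M" by (rule bij_betw_AL[OF mu])
  have G_AL: "G (A (L f)) = f" if "f \<in> M" for f
    unfolding G_def using bij_betw_inv_into_left[OF bij that] .
  have surj: "\<exists>h\<in>M. A (L h) = g" if "g \<in> M" for g using AL_surj[OF mu that] .
  have upper: "norm (G g) / norm g \<le> 1 / \<mu>\<^sup>2" if "g \<in> M" for g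
  proof -
    obtain f where f: "f \<in> M" "A (L f) = g" using surj[OF \<open>g \<in> M\<close>] by blast
    have "norm f * \<mu>\<^sup>2 \<le> norm g"
      using norm_le_norm_AL[OF mu f(1)] f(2) by (simp add: mult.commute)
    then show ?thesis
      using mu0 G_AL[OF f(1)] f(2) by (cases "g = 0") (simp_all add: field_simps)
  qed
  define c where "c = (SUP g\<in>M. norm (G g) / norm g)"
  have bdd: "bdd_above ((\<lambda>g. norm (G g) / norm g) ` M)"
    using upper by (intro bdd_aboveI2)
  have "M \<noteq> {}" using M_nontrivial by blast
  then have "c \<le> 1 / \<mu>\<^sup>2" unfolding c_def using upper by (intro cSUP_least)
  have c_ge: "norm f \<le> c * norm (A (L f))" if "f \<in> M" for f
  proof (cases "f = 0")
    case False
    then have "A (L f) \<noteq> 0"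
      using M_AL_inject[OF that, of 0] subspace_0[OF subspace_M] by auto
    moreover have "norm (G (A (L f))) / norm (A (L f)) \<le> c"
      unfolding c_def by (rule cSUP_upper[OF A_in_M bdd])
    ultimately show ?thesis using G_AL[OF that] by (simp add: pos_divide_le_eq)
  qed simp
  obtain f where f: "f \<in> M" "f \<noteq> 0" using M_nontrivial by blast
  then have "0 < norm f" by simp
  also have "\<dots> \<le> c * norm (A (L f))" by (rule c_ge[OF f(1)])
  finally have "0 < c" by (simp add: zero_less_mult_iff)
  then have "bound (1 / sqrt c)" 
    by (intro bound_of_inverse_bound surj c_ge)
  then have "1 / sqrt c \<le> \<mu>"
    unfolding \<mu>_def by (rule stability_constant_greatest(2)[OF assms(1)])
  then have "(1 / sqrt c)\<^sup>2 \<le> \<mu>\<^sup>2" using \<open>0 < c\<close> by (intro power_mono) auto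
  then have "1 / c \<le> \<mu>\<^sup>2" using \<open>0 < c\<close> by (simp add: power_divide)
  then have "1 / \<mu>\<^sup>2 \<le> c" using \<open>0 < c\<close> mu0 by (simp add: field_simps)
  with \<open>c \<le> 1 / \<mu>\<^sup>2\<close> have "c = 1 / \<mu>\<^sup>2" by simp
  with bdd show ?thesis unfolding has_onorm_on_def c_def G_def by simp
qed

subsection \<open>Bounded partial sums force stability\<close>

text \<open>Expand the square of \<open>x - \<gamma> *\<^sub>R A (L x)\<close>, and estimate the
  quadratic term by \<open>norm (A (L x)) \<le> norm L * norm (L x)\<close>. The step-size condition
  makes the factor on the left positive.\<close>

lemma norm_T_decrease: "\<gamma> * (2 - \<gamma> * (norm L)\<^sup>2) * (norm (L x))\<^sup>2 \<le> (norm x)\<^sup>2 - (norm (T x))\<^sup>2"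
proof -
  have "(norm (T x))\<^sup>2 = (norm x)\<^sup>2 - 2 * \<gamma> * (norm (L x))\<^sup>2 + \<gamma>\<^sup>2 * (norm (A (L x)))\<^sup>2"
    unfolding T_apply power2_norm_eq_inner using inner_AL[of x x]
    by (simp add: inner_diff_left inner_diff_right inner_commute
        power2_eq_square algebra_simps)
  moreover have "(norm (A (L x)))\<^sup>2 \<le> (norm L * norm (L x))\<^sup>2"
    by (intro power_mono norm_adjoint_le adjoint) simp
  then have "\<gamma>\<^sup>2 * (norm (A (L x)))\<^sup>2 \<le> \<gamma>\<^sup>2 * (norm L * norm (L x))\<^sup>2"
    by (intro mult_left_mono) auto
  ultimately show ?thesis by (simp add: power2_eq_square algebra_simps)
qed

lemma L_P_tendsto_zero: "(\<lambda>k. L (P k x)) \<longlonglongrightarrow> 0"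
proof -
  define c where "c = \<gamma> * (2 - \<gamma> * (norm L)\<^sup>2)"
  have c: "0 < c" unfolding c_def using gamma(1) gamma_norm_L by simp
  \<comment> \<open>The sequence \<open>u\<close> decreases and is nonnegative, so its consecutive
    differences tend to 0, and they dominate \<open>c * (norm (L (P k x)))\<^sup>2\<close>.\<close>
  define u where "u k = (norm (P k x))\<^sup>2" for k
  have step: "c * (norm (L (P k x)))\<^sup>2 \<le> u k - u (Suc k)" for k
    using norm_T_decrease[of "P k x"] by (simp add: u_def c_def)
  have "0 \<le> c * (norm (L (P k x)))\<^sup>2" for k using c by simp
  then have "u (Suc k) \<le> u k" for k using step[of k] by (meson diff_ge_0_iff_ge order_trans)
  then have "decseq u" by (rule decseq_SucI)
  moreover have "0 \<le> u k" for k by (simp add: u_def)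
  ultimately obtain l where l: "u \<longlonglongrightarrow> l" using decseq_convergent by metis
  have "(\<lambda>k. u k - u (Suc k)) \<longlonglongrightarrow> l - l" by (intro tendsto_diff l LIMSEQ_Suc)
  then have lim: "(\<lambda>k. (u k - u (Suc k)) / c) \<longlonglongrightarrow> 0" using tendsto_divide_zero by fastforce
  have "(norm (L (P k x)))\<^sup>2 \<le> (u k - u (Suc k)) / c" for k
    using step[of k] c by (simp add: pos_le_divide_eq mult.commute)
  then have "(\<lambda>k. (norm (L (P k x)))\<^sup>2) \<longlonglongrightarrow> 0"
    by (intro Lim_null_comparison[OF always_eventually lim]) simp
  then have "(\<lambda>k. sqrt ((norm (L (P k x)))\<^sup>2)) \<longlonglongrightarrow> sqrt 0" by (rule tendsto_real_sqrt)
  then show ?thesis by (simp add: tendsto_norm_zero_iff)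
qed

lemma stable_if_S_bounded:
  assumes "\<And>N. norm (S N) \<le> C"
  shows "is_stable inner L"
proof -
  \<comment> \<open>The maximum with 1 makes the constant positive, as needed for the bound
    \<open>1 / D\<close>.\<close>
  define D where "D = max C 1"
  have D: "0 < D" "norm (S N) \<le> D" for N
    using assms[of N] by (auto simp: D_def)
  have diff_le: "norm (x - P N x) \<le> D * norm (L x)" for N x
  proof -
    have "norm (x - P N x) = norm (S N (L x))" by (simp add: S_apply)
    also have "\<dots> \<le> norm (S N) * norm (L x)" by (rule norm_blinfun)
    also have "\<dots> \<le> D * norm (L x)" using D by (intro mult_right_mono) auto
    finally show ?thesis .
  qed
  have "norm f \<le> D * norm (L f)" if f: "f \<in> M" for f
  proof -
    have "Cauchy (\<lambda>k. P k f)"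
    proof (rule CauchyI')
      fix e :: real assume "0 < e"
      then have "0 < e / D" using D by simp
      then obtain k0 where k0: "\<And>k. k \<ge> k0 \<Longrightarrow> norm (L (P k f)) < e / D"
        using LIMSEQ_D[OF L_P_tendsto_zero[of f]] by (metis diff_zero)
      have "norm (P k f - P n f) < e" if "k \<ge> k0" "n > k" for k n
      proof -
        \<comment> \<open>This reduces the Cauchy estimate to \<open>diff_le\<close> at the point
          \<open>P k f\<close>.\<close>
        have "P n f = P (n - k) (P k f)"
          using blinfun_power_add[of T "n - k" k f] that by simp
        then have "norm (P k f - P n f) \<le> D * norm (L (P k f))" using diff_le by simp
        also have "\<dots> < e" using k0[OF that(1)] D by (simp add: pos_less_divide_eq mult.commute)
        finally show ?thesis .
      qed
      then show "\<exists>M. \<forall>m\<ge>M. \<forall>n>m. dist (P m f) (P n f) < e" unfolding dist_norm by blast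
    qed
    then obtain g where g: "(\<lambda>k. P k f) \<longlonglongrightarrow> g" using Cauchy_convergent convergent_def by blast
    have "P k f \<in> M" for k by (induction k) (simp_all add: f T_in_M)
    then have "g \<in> M" using closed_sequentially[OF closed_M _ g] by blast
    have "(\<lambda>k. L (P k f)) \<longlonglongrightarrow> L g" by (intro tendsto_intros g)
    then have "L g = 0" using L_P_tendsto_zero LIMSEQ_unique by blast
    with \<open>g \<in> M\<close> have "g = 0" by (rule M_ker_zero)
    then have "(\<lambda>k. norm (f - P k f)) \<longlonglongrightarrow> norm (f - 0)"
      using g by (intro tendsto_intros) simp
    then show ?thesis using LIMSEQ_le_const2[of _ "norm f" "D * norm (L f)"] diff_le by simp
  qed
  then have "bound (1 / D)" using D(1) by (simp add: bound_iff pos_divide_le_eq mult.commute)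
  then show ?thesis unfolding is_stable_def by blast
qed

end

section \<open>Transfer to scalar products over \<open>'k\<close>\<close>

theorem theorem3p2:
  fixes scale1 :: "'k::rc_field \<Rightarrow> 'a::{real_inner, complete_space} \<Rightarrow> 'a"
    and ip1 :: "'a \<Rightarrow> 'a \<Rightarrow> 'k"
    and scale2 :: "'k \<Rightarrow> 'b::{real_inner, complete_space} \<Rightarrow> 'b"
    and ip2 :: "'b \<Rightarrow> 'b \<Rightarrow> 'k"
    and L :: "'a \<Rightarrow>\<^sub>L 'b"
    and \<gamma> :: real
  defines "Ls \<equiv> adj ip1 ip2 L"
    and "M \<equiv> orth_compl ip1 (Ker L)"
    and "S \<equiv> neumann_sum ip1 ip2 L \<gamma>"
    and "t \<equiv> neumann_term ip1 ip2 L \<gamma>"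
  assumes H1: "hilbert_space scale1 ip1"
    and H2: "hilbert_space scale2 ip2"
    and lin: "\<And>c x. L (scale1 c x) = scale2 c (L x)"
    and nonzero: "L \<noteq> 0"
    and gamma: "0 < \<gamma>" "\<gamma> < 2 / (norm L)\<^sup>2"
  shows "((\<forall>m. summable (\<lambda>j. t j m)) \<longleftrightarrow> is_stable ip1 L) \<and>
    (is_stable ip1 L \<longrightarrow>
      (let \<mu> = stability_constant ip1 L; \<nu> = min (\<gamma> * \<mu>\<^sup>2) (2 - \<gamma> * (norm L)\<^sup>2) in
        stability_bound ip1 L \<mu> \<and>
        bij_betw (\<lambda>f. Ls (L f)) M M \<and>
        has_onorm_on (inv_into M (\<lambda>f. Ls (L f))) M (1 / \<mu>\<^sup>2) \<and>
        (\<forall>m. \<exists>!f. f \<in> M \<and> Ls (L f) = Ls m) \<and>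
        (\<forall>m. \<forall>f\<in>M. Ls (L f) = Ls m \<longrightarrow>
          (\<lambda>j. t j m) sums f \<and>
          (\<forall>N\<ge>1. norm (S N m - f) \<le> (1 - \<nu>) ^ N / \<mu> * norm m)) \<and>
        (\<exists>S'. S \<longlonglongrightarrow> S' \<and> (\<forall>N\<ge>1. norm (S N - S') \<le> (1 - \<nu>) ^ N / \<mu>)))) \<and>
    (\<not> is_stable ip1 L \<longrightarrow>
      \<not> convergent S \<and>
      \<not> (\<forall>m. convergent (\<lambda>N. S N m)) \<and>
      residual {m. \<not> bounded (range (\<lambda>N. S N m))} \<and>
      closure {m. \<not> bounded (range (\<lambda>N. S N m))} = UNIV \<and>
      (\<forall>m. \<not> bounded (range (\<lambda>N. S N m)) \<longrightarrow> \<not> summable (\<lambda>j. t j m)))"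
proof -
  obtain A :: "'b \<Rightarrow>\<^sub>L 'a" where A: "\<And>x y. inner (L x) y = inner x (A y)"
    using adjoint_exists by blast
  interpret lw: landweber L A \<gamma>
    by unfold_locales (use A nonzero gamma in auto)
  interpret H1: hilbert_space scale1 ip1 by (rule H1)
  interpret H2: hilbert_space scale2 ip2 by (rule H2)
  have Ls: "Ls = A"
    unfolding Ls_def by (rule adj_eqI[OF H1 H2 lin A])
  \<comment> \<open>Scalar linearity of \<open>L\<close> makes its kernel closed under
    \<open>scale1\<close>, so both notions of orthogonality agree on it.\<close>
  have orth: "orth_compl ip1 (Ker L) = orth_compl inner (Ker L)"
    by (rule orth_compl_ip_eq_inner[OF H1]) (simp add: Ker_def lin)
  have M_eq: "M = lw.M"
    by (simp add: M_def lw.M_def orth)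
  have bound_eq: "stability_bound ip1 L = lw.bound"
    by (rule ext) (simp add: stability_bound_def orth)
  have stable_eq: "is_stable ip1 L = is_stable inner L"
    and const_eq: "stability_constant ip1 L = stability_constant inner L"
    by (simp_all add: is_stable_def stability_constant_def bound_eq)
  have t_eq: "t j = lw.P j o\<^sub>L (\<gamma> *\<^sub>R A)" for j
    using Ls by (simp add: t_def Ls_def neumann_term_def lw.T_def)
  have S_sum: "S = (\<lambda>N. \<Sum>j<N. t j)"
    by (rule ext) (simp add: S_def t_def neumann_sum_def)
  have S_eq: "S = lw.S"
    by (rule ext) (simp add: S_sum t_eq lw.S_def)
  have sums_iff: "(\<lambda>j. t j m) sums f \<longleftrightarrow> (\<lambda>N. S N m) \<longlonglongrightarrow> f" for m f
    by (simp add: sums_def S_sum blinfun.sum_left)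
  have summable_iff: "summable (\<lambda>j. t j m) \<longleftrightarrow> convergent (\<lambda>N. S N m)" for m
    by (simp add: summable_def sums_iff convergent_def)
  have conv_bounded: "bounded (range (\<lambda>N. S N m))" if "convergent (\<lambda>N. S N m)" for m
    using convergent_imp_bounded that unfolding convergent_def by blast

  have stable: "let \<mu> = stability_constant ip1 L; \<nu> = min (\<gamma> * \<mu>\<^sup>2) (2 - \<gamma> * (norm L)\<^sup>2) in
        stability_bound ip1 L \<mu> \<and>
        bij_betw (\<lambda>f. Ls (L f)) M M \<and>
        has_onorm_on (inv_into M (\<lambda>f. Ls (L f))) M (1 / \<mu>\<^sup>2) \<and>
        (\<forall>m. \<exists>!f. f \<in> M \<and> Ls (L f) = Ls m) \<and>
        (\<forall>m. \<forall>f\<in>M. Ls (L f) = Ls m \<longrightarrow>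
          (\<lambda>j. t j m) sums f \<and>
          (\<forall>N\<ge>1. norm (S N m - f) \<le> (1 - \<nu>) ^ N / \<mu> * norm m)) \<and>
        (\<exists>S'. S \<longlonglongrightarrow> S' \<and> (\<forall>N\<ge>1. norm (S N - S') \<le> (1 - \<nu>) ^ N / \<mu>))"
    if st: "is_stable ip1 L"
  proof -
    have st': "is_stable inner L" using st by (simp add: stable_eq)
    note bd = lw.stability_constant_greatest(1)[OF st']
    \<comment> \<open>Folding \<open>rate\<close> replaces 1 - \<nu> in the goal. The estimates in
      the locale hold for every \<open>N\<close>, including 0.\<close>
    show ?thesis
      unfolding Let_def const_eq bound_eq Ls M_eq S_eq sums_iff lw.rate_def[symmetric]
      using bd lw.bij_betw_AL[OF bd] lw.has_onorm_on_inverse[OF st'] lw.ex1_solution[OF bd]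
        lw.S_tendsto_solution[OF bd] lw.norm_S_diff_le[OF bd] lw.uniform_limit_S[OF bd]
      by blast
  qed

  have unstable: "residual {m. \<not> bounded (range (\<lambda>N. S N m))} \<and> \<not> convergent S"
    if "\<not> is_stable ip1 L"
  proof -
    have unbdd: "\<not> (\<exists>C. \<forall>N. norm (S N) \<le> C)"
      using that lw.stable_if_S_bounded unfolding S_eq stable_eq by blast
    then have "\<not> convergent S"
      using convergent_imp_bounded[of S] unfolding convergent_def bounded_iff by blast
    with unbdd show ?thesis using residual_unbounded_orbits by blast
  qed
  have dense: "closure {m. \<not> bounded (range (\<lambda>N. S N m))} = UNIV" if "\<not> is_stable ip1 L"
    using residual_imp_dense unstable[OF that] by blast
  \<comment> \<open>A dense set is nonempty because the empty set is its own closure; one unbounded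
    orbit then already excludes strong convergence.\<close>
  then have "\<exists>m. \<not> bounded (range (\<lambda>N. S N m))" if "\<not> is_stable ip1 L"
    using that by (metis (no_types, lifting) UNIV_not_empty closure_empty empty_Collect_eq)
  then have not_conv: "\<exists>m. \<not> convergent (\<lambda>N. S N m)" if "\<not> is_stable ip1 L"
    using that conv_bounded by blast
  have conv: "convergent (\<lambda>N. S N m)" if "is_stable ip1 L" for m
  proof -
    have st: "is_stable inner L" using that by (simp add: stable_eq)
    note bd = lw.stability_constant_greatest(1)[OF st]
    obtain f where "f \<in> lw.M" "A (L f) = A m" using lw.ex1_solution[OF bd] by blast
    then have "(\<lambda>N. S N m) \<longlonglongrightarrow> f" unfolding S_eq by (rule lw.S_tendsto_solution[OF bd])
    then show ?thesis by (rule convergentI)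
  qed
  have "(\<forall>m. summable (\<lambda>j. t j m)) \<longleftrightarrow> is_stable ip1 L"
    unfolding summable_iff using not_conv conv by blast
  moreover have "\<not> summable (\<lambda>j. t j m)" if "\<not> bounded (range (\<lambda>N. S N m))" for m
    using that conv_bounded summable_iff by blast
  moreover have "\<not> (\<forall>m. convergent (\<lambda>N. S N m))" if "\<not> is_stable ip1 L"
    using not_conv[OF that] by blast
  ultimately show ?thesis
    using stable unstable dense by (intro conjI impI) simp_all
qed

end
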